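(* Let $\epsilon=(\epsilon_j)_{j\ge0}\in\{-1,1\}^{\mathbb N}$, $\eta_j=\frac12(\epsilon_j+1)$, $P_q(z)=\frac1{\sqrt q}\sum_{j=0}^{q-1}\epsilon_jz^j$, $Q_q(z)=\frac2{\sqrt q}\sum_{j=0}^{q-1}\eta_jz^j$, and assume $\int_{S^1}\big||P_q(z)|^2-1\big|^2dz\to0$ as $q\to\infty$. Then the sequence $\Big(\frac1q\sum_{j=1}^{q-1}|Q_q(\xi_{q,j})|^4\Big)_{q\ge1}$ does not converge to $1$, where $\xi_{q,j}=e^{2\pi i j/q}$.
   Context: $S^1$ is the unit circle with normalized Lebesgue measure $dz$. *)

theory Defs
  imports "HOL-Probability.Probability"
begin

text \<open>
  Normalized Lebesgue measure on the unit circle, as a measure on the complex plane: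
  the push-forward of the uniform distribution on the interval from 0 to 2 pi under
  the map sending t to exp(i t).
\<close>
definition circle_measure :: "complex measure" where
  "circle_measure = distr (uniform_measure lborel {0..<2 * pi}) borel cis"

definition eta :: "(nat \<Rightarrow> real) \<Rightarrow> nat \<Rightarrow> real" where
  "eta \<epsilon> j = (1 / 2) * (\<epsilon> j + 1)"

definition P :: "(nat \<Rightarrow> real) \<Rightarrow> nat \<Rightarrow> complex \<Rightarrow> complex" where
  "P \<epsilon> q z = complex_of_real (1 / sqrt (real q)) * (\<Sum>j<q. complex_of_real (\<epsilon> j) * z ^ j)"

definition Q :: "(nat \<Rightarrow> real) \<Rightarrow> nat \<Rightarrow> complex \<Rightarrow> complex" where
  "Q \<epsilon> q z = complex_of_real (2 / sqrt (real q)) * (\<Sum>j<q. complex_of_real (eta \<epsilon> j) * z ^ j)"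

definition xi :: "nat \<Rightarrow> nat \<Rightarrow> complex" where
  "xi q j = exp (2 * complex_of_real pi * \<i> * of_nat j / of_nat q)"

end

theory Submission
  imports Defs
begin

text \<open>
  No sequence of signs satisfies the flatness hypothesis. With
  \<open>A k n = (\<Sum>j<n. \<epsilon> j * \<epsilon> (j + k))\<close>, the integral for \<open>q\<close> equals \<open>2 / q\<^sup>2\<close> times
  \<open>E q = (\<Sum>k = 1..<q. (A k (q - k))\<^sup>2)\<close>, so the hypothesis says that \<open>E q = o(q\<^sup>2)\<close>.
  Let \<open>F\<close> and \<open>G\<close> be the polynomials of the blocks \<open>{..<q}\<close> and \<open>{q..<2*q}\<close>. Computing the
  integral of \<open>\<bar>F\<bar>\<^sup>2 * \<bar>G\<bar>\<^sup>2\<close> from the autocorrelations of the two blocks gives about \<open>q\<^sup>2\<close>.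
  Computing it from their cross-correlations, which are differences of values \<open>A k n\<close>, bounds it
  by \<open>E q\<close>, \<open>E (2*q)\<close> and \<open>(\<Sum>k = 1..<q. (A k q)\<^sup>2)\<close>. Since \<open>A k q\<close> is the
  autocorrelation at shift \<open>k\<close> of the prefix of length \<open>q + k\<close>, the last quantity is \<open>o(q\<^sup>2)\<close>
  on average over \<open>q \<in> {N..<2*N}\<close>, and so for suitable \<open>q\<close> all three are too small.
\<close>

section \<open>Cross-correlations of finite blocks\<close>

text \<open>On the unit circle this is the coefficient of \<open>z^d\<close> in the product of the
  conjugate of \<open>\<Sum>i\<in>I. f i * z^i\<close> with \<open>\<Sum>j\<in>J. f j * z^j\<close>.
  The shift is an integer because negative powers occur.\<close>

definition xcorr :: "(nat \<Rightarrow> real) \<Rightarrow> nat set \<Rightarrow> nat set \<Rightarrow> int \<Rightarrow> real" where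
  "xcorr f I J d = (\<Sum>i\<in>I. \<Sum>j\<in>J. if int j - int i = d then f i * f j else 0)"

text \<open>Groups index pairs by their difference. Later \<open>h\<close> is either another
  correlation or a cosine.\<close>

lemma sum_xcorr:
  assumes "finite K" "\<And>i j. i \<in> I \<Longrightarrow> j \<in> J \<Longrightarrow> int j - int i \<in> K"
  shows "(\<Sum>d\<in>K. xcorr f I J d * h d) = (\<Sum>i\<in>I. \<Sum>j\<in>J. f i * f j * h (int j - int i))"
proof -
  have "(\<Sum>d\<in>K. xcorr f I J d * h d)
      = (\<Sum>d\<in>K. \<Sum>i\<in>I. \<Sum>j\<in>J. if int j - int i = d then f i * f j * h d else 0)"
    by (simp add: xcorr_def sum_distrib_right if_distrib[of "\<lambda>x. x * _"] cong: if_cong)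
  also have "\<dots> = (\<Sum>i\<in>I. \<Sum>d\<in>K. \<Sum>j\<in>J. if int j - int i = d then f i * f j * h d else 0)"
    by (rule sum.swap)
  also have "\<dots> = (\<Sum>i\<in>I. \<Sum>j\<in>J. \<Sum>d\<in>K. if int j - int i = d then f i * f j * h d else 0)"
    by (intro sum.cong refl sum.swap)
  also have "\<dots> = (\<Sum>i\<in>I. \<Sum>j\<in>J. f i * f j * h (int j - int i))"
    using assms by (intro sum.cong refl) (simp add: sum.delta')
  finally show ?thesis .
qed

lemma xcorr_minus: "xcorr f I J (- d) = xcorr f J I d"
proof -
  have "xcorr f I J (- d) = (\<Sum>j\<in>J. \<Sum>i\<in>I. if int j - int i = - d then f i * f j else 0)"
    unfolding xcorr_def by (rule sum.swap)
  also have "\<dots> = xcorr f J I d"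
    unfolding xcorr_def by (intro sum.cong refl) (auto simp: mult.commute)
  finally show ?thesis .
qed

text \<open>Both sides sum over the same quadruples, since \<open>j' - i' = j - i\<close> holds
  exactly when \<open>j' - j = i' - i\<close>. This is the discrete form of the two evaluations of
  the integral of a product of two squared moduli.\<close>

lemma sum_xcorr_squared:
  assumes "finite K" "finite L"
    and "\<And>i j. i \<in> I \<Longrightarrow> j \<in> J \<Longrightarrow> int j - int i \<in> K"
    and "\<And>i j. i \<in> I \<Longrightarrow> j \<in> I \<Longrightarrow> int j - int i \<in> L"
  shows "(\<Sum>d\<in>K. (xcorr f I J d)\<^sup>2) = (\<Sum>d\<in>L. xcorr f I I d * xcorr f J J d)"
proof -
  have "(\<Sum>d\<in>K. (xcorr f I J d)\<^sup>2)
      = (\<Sum>i\<in>I. \<Sum>j\<in>J. f i * f j * xcorr f I J (int j - int i))"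
    using assms by (simp add: power2_eq_square sum_xcorr)
  also have "\<dots> = (\<Sum>i\<in>I. \<Sum>j\<in>J. \<Sum>i'\<in>I. \<Sum>j'\<in>J.
      if int j' - int i' = int j - int i then f i * f j * (f i' * f j') else 0)"
    by (simp add: xcorr_def sum_distrib_left if_distrib[of "\<lambda>x. _ * x"] cong: if_cong)
  also have "\<dots> = (\<Sum>i\<in>I. \<Sum>i'\<in>I. \<Sum>j\<in>J. \<Sum>j'\<in>J.
      if int j' - int i' = int j - int i then f i * f j * (f i' * f j') else 0)"
    by (intro sum.cong refl sum.swap)
  also have "\<dots> = (\<Sum>i\<in>I. \<Sum>i'\<in>I. \<Sum>j\<in>J. \<Sum>j'\<in>J.
      if int j' - int j = int i' - int i then f i * f i' * (f j * f j') else 0)"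
    by (intro sum.cong refl) auto
  also have "\<dots> = (\<Sum>i\<in>I. \<Sum>i'\<in>I. f i * f i' * xcorr f J J (int i' - int i))"
    by (simp add: xcorr_def sum_distrib_left if_distrib[of "\<lambda>x. _ * x"] cong: if_cong)
  also have "\<dots> = (\<Sum>d\<in>L. xcorr f I I d * xcorr f J J d)"
    using assms by (simp add: sum_xcorr)
  finally show ?thesis .
qed

lemma xcorr_of_nat:
  assumes "finite I" "finite J"
  shows "xcorr f I J (int k) = (\<Sum>i | i \<in> I \<and> i + k \<in> J. f i * f (i + k))"
proof -
  have "xcorr f I J (int k) = (\<Sum>i\<in>I. \<Sum>j\<in>J. if j = i + k then f i * f j else 0)"
    unfolding xcorr_def by (intro sum.cong refl) auto
  also have "\<dots> = (\<Sum>i\<in>I. if i + k \<in> J then f i * f (i + k) else 0)"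
    using assms by (simp add: sum.delta)
  also have "\<dots> = (\<Sum>i | i \<in> I \<and> i + k \<in> J. f i * f (i + k))"
    using assms by (simp add: sum.inter_filter)
  finally show ?thesis .
qed

section \<open>Autocorrelations of prefixes and adjacent blocks\<close>

text \<open>The number \<open>n\<close> of products is kept independent of \<open>k\<close>; the
  aperiodic autocorrelation of the prefix of length \<open>q\<close> is
  \<open>acorr f k (q - k)\<close>.\<close>

definition acorr :: "(nat \<Rightarrow> real) \<Rightarrow> nat \<Rightarrow> nat \<Rightarrow> real" where
  "acorr f k n = (\<Sum>j<n. f j * f (j + k))"

text \<open>The energy of the merit factor problem for binary sequences.\<close>

definition energy :: "(nat \<Rightarrow> real) \<Rightarrow> nat \<Rightarrow> real" where
  "energy f q = (\<Sum>k = 1..<q. (acorr f k (q - k))\<^sup>2)"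

lemma acorr_diff:
  assumes "m \<le> n"
  shows "acorr f k n - acorr f k m = (\<Sum>j = m..<n. f j * f (j + k))"
  using assms by (simp add: acorr_def sum_diff_nat_ivl lessThan_atLeast0)

lemma xcorr_initial: "xcorr f {..<q} {..<q} (int k) = acorr f k (q - k)"
  by (auto simp: xcorr_of_nat acorr_def intro!: sum.cong)

lemma xcorr_second:
  assumes "k \<le> q"
  shows "xcorr f {q..<2*q} {q..<2*q} (int k) = acorr f k (2*q - k) - acorr f k q"
  using assms by (subst acorr_diff) (auto simp: xcorr_of_nat intro!: sum.cong)

text \<open>Here the pairs start at \<open>q - k \<le> i < q\<close>. For larger shifts the end of
  the second block cuts the range to \<open>i < 2*q - k\<close>.\<close>

lemma xcorr_first_second_le:
  assumes "k \<le> q"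
  shows "xcorr f {..<q} {q..<2*q} (int k) = acorr f k q - acorr f k (q - k)"
  using assms by (subst acorr_diff) (auto simp: xcorr_of_nat intro!: sum.cong)

lemma xcorr_first_second_ge:
  assumes "q \<le> k"
  shows "xcorr f {..<q} {q..<2*q} (int k) = acorr f k (2*q - k)"
  using assms by (auto simp: xcorr_of_nat acorr_def intro!: sum.cong)

lemma sum_symmetric_interval:
  fixes g :: "int \<Rightarrow> real"
  assumes "0 < q" "\<And>d. g (- d) = g d"
  shows "(\<Sum>d\<in>{- int q<..<int q}. g d) = g 0 + 2 * (\<Sum>k = 1..<q. g (int k))"
proof -
  have *: "{- int q<..<int q} = insert 0 (int ` {1..<q} \<union> (\<lambda>k. - int k) ` {1..<q})"
  proof (intro equalityI subsetI)
    fix d assume "d \<in> {- int q<..<int q}"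
    then have "nat \<bar>d\<bar> < q" by auto
    then show "d \<in> insert 0 (int ` {1..<q} \<union> (\<lambda>k. - int k) ` {1..<q})"
      by (cases d rule: int_cases3) auto
  qed (use assms in auto)
  show ?thesis
    unfolding * using assms
    by (subst sum.insert, simp, force, subst sum.union_disjoint)
       (auto simp: sum.reindex inj_on_def)
qed

lemma acorr_zero:
  assumes "\<And>j. f j \<in> {-1, 1}"
  shows "acorr f 0 n = real n"
proof -
  have "f j * f j = 1" for j using assms[of j] by auto
  then show ?thesis by (simp add: acorr_def)
qed

section \<open>Lower bound for the energy\<close>

text \<open>Applies \<open>sum_xcorr_squared\<close> to two adjacent blocks of length
  \<open>q\<close>. The shift \<open>0\<close> contributes the main term \<open>q * q\<close>; all
  other terms are absorbed by elementary quadratic inequalities.\<close>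

lemma square_le_energy:
  assumes f: "\<And>j. f j \<in> {-1, 1}" and "0 < q"
  shows "(real q)\<^sup>2 \<le> 4 * (\<Sum>k = 1..<q. (acorr f k q)\<^sup>2) + 3 * energy f q + 2 * energy f (2*q)"
proof -
  define G where "G = (\<Sum>k = 1..<q. (acorr f k q)\<^sup>2)"
  define B where "B = (\<Sum>k = 1..<q. (acorr f k (2*q - k))\<^sup>2)"
  have split: "(\<Sum>k = 1..<2*q. h k) = (\<Sum>k = 1..<q. h k) + (\<Sum>k = q..<2*q. h k)" for h :: "nat \<Rightarrow> real"
    using \<open>0 < q\<close> by (subst sum.atLeastLessThan_concat) auto
  \<comment> \<open>The shifts \<open>k \<ge> q\<close> in \<open>energy f (2*q)\<close> are exactly
    squared cross-correlations of the two blocks; \<open>B\<close> collects the shifts below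
    \<open>q\<close>.\<close>
  have E2: "energy f (2*q) = B + (\<Sum>k = q..<2*q. (acorr f k (2*q - k))\<^sup>2)"
    unfolding energy_def B_def by (rule split)
  have "(\<Sum>d\<in>int ` {1..<2*q}. (xcorr f {..<q} {q..<2*q} d)\<^sup>2)
      = (\<Sum>d\<in>{- int q<..<int q}. xcorr f {..<q} {..<q} d * xcorr f {q..<2*q} {q..<2*q} d)"
  proof (rule sum_xcorr_squared)
    fix i j assume "i \<in> {..<q}" "j \<in> {q..<2*q}"
    then show "int j - int i \<in> int ` {1..<2*q}"
      by (intro image_eqI[of _ _ "j - i"]) auto
  qed auto
  also have "\<dots> = (real q)\<^sup>2 + 2 * (\<Sum>k = 1..<q. acorr f k (q - k) * (acorr f k (2*q - k) - acorr f k q))"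
    using \<open>0 < q\<close> by (subst sum_symmetric_interval)
      (auto simp: xcorr_minus xcorr_initial xcorr_second
        xcorr_initial[of f q 0, simplified] xcorr_second[of 0 q f, simplified]
        acorr_zero[OF f] power2_eq_square)
  finally have "(real q)\<^sup>2 = (\<Sum>k = 1..<2*q. (xcorr f {..<q} {q..<2*q} (int k))\<^sup>2)
      - 2 * (\<Sum>k = 1..<q. acorr f k (q - k) * (acorr f k (2*q - k) - acorr f k q))"
    by (simp add: sum.reindex)
  also have "(\<Sum>k = 1..<2*q. (xcorr f {..<q} {q..<2*q} (int k))\<^sup>2)
      = (\<Sum>k = 1..<q. (acorr f k q - acorr f k (q - k))\<^sup>2) + (energy f (2*q) - B)"
    unfolding split E2 by (simp add: xcorr_first_second_le xcorr_first_second_ge)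
  finally have eq: "(real q)\<^sup>2 = (\<Sum>k = 1..<q. (acorr f k q - acorr f k (q - k))\<^sup>2)
      + (energy f (2*q) - B)
      - 2 * (\<Sum>k = 1..<q. acorr f k (q - k) * (acorr f k (2*q - k) - acorr f k q))" .
  have le1: "(\<Sum>k = 1..<q. (acorr f k q - acorr f k (q - k))\<^sup>2) \<le> 2 * G + 2 * energy f q"
    unfolding G_def energy_def sum_distrib_left sum.distrib[symmetric]
  proof (intro sum_mono)
    fix k
    let ?a = "acorr f k (q - k)" and ?g = "acorr f k q"
    have "0 \<le> (?a + ?g)\<^sup>2" by simp
    then show "(?g - ?a)\<^sup>2 \<le> 2 * ?g\<^sup>2 + 2 * ?a\<^sup>2"
      by (simp add: power2_eq_square algebra_simps)
  qed
  have le2: "- (2 * (\<Sum>k = 1..<q. acorr f k (q - k) * (acorr f k (2*q - k) - acorr f k q)))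
      \<le> energy f q + (2 * B + 2 * G)"
    unfolding G_def B_def energy_def sum_distrib_left sum.distrib[symmetric] sum_negf[symmetric]
  proof (intro sum_mono)
    fix k
    let ?a = "acorr f k (q - k)" and ?b = "acorr f k (2*q - k)" and ?g = "acorr f k q"
    \<comment> \<open>The second square cancels the mixed term \<open>?b * ?g\<close> left by the
      first.\<close>
    have "0 \<le> (?a + (?b - ?g))\<^sup>2 + (?b + ?g)\<^sup>2" by simp
    then show "- (2 * (?a * (?b - ?g))) \<le> ?a\<^sup>2 + (2 * ?b\<^sup>2 + 2 * ?g\<^sup>2)"
      by (simp add: power2_eq_square algebra_simps)
  qed
  have "(real q)\<^sup>2 \<le> 4 * G + 3 * energy f q + energy f (2*q) + B"
    using eq le1 le2 by linarith
  moreover have "B \<le> energy f (2*q)" unfolding E2 by (simp add: sum_nonneg)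
  ultimately show ?thesis unfolding G_def by simp
qed

text \<open>The injective substitution of \<open>q + k\<close> for \<open>q\<close> turns each term
  into one of \<open>energy f (q + k)\<close>, and \<open>q + k < 2 * q < 4 * N\<close>.\<close>

lemma sum_acorr_le_sum_energy:
  "(\<Sum>q = N..<2*N. \<Sum>k = 1..<q. (acorr f k q)\<^sup>2) \<le> (\<Sum>q = N..<4*N. energy f q)"
proof -
  have "(\<Sum>q = N..<2*N. \<Sum>k = 1..<q. (acorr f k q)\<^sup>2)
      = (\<Sum>(q, k)\<in>(SIGMA q:{N..<2*N}. {1..<q}). (acorr f k q)\<^sup>2)"
    by (simp add: sum.Sigma)
  also have "\<dots> = (\<Sum>(q, k)\<in>(\<lambda>(q, k). (q + k, k)) ` (SIGMA q:{N..<2*N}. {1..<q}). (acorr f k (q - k))\<^sup>2)"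
    by (subst sum.reindex) (auto simp: inj_on_def intro!: sum.cong)
  also have "\<dots> \<le> (\<Sum>(q, k)\<in>(SIGMA q:{N..<4*N}. {1..<q}). (acorr f k (q - k))\<^sup>2)"
    by (intro sum_mono2) auto
  also have "\<dots> = (\<Sum>q = N..<4*N. energy f q)"
    unfolding energy_def by (simp add: sum.Sigma)
  finally show ?thesis .
qed

text \<open>Averages \<open>square_le_energy\<close> over \<open>q\<close> from \<open>N\<close> to
  \<open>2*N - 1\<close>, because \<open>acorr f k q\<close> is controlled only on average.\<close>

lemma energy_not_small:
  assumes f: "\<And>j. f j \<in> {-1, 1}" and "0 < N"
    and small: "\<And>q. N \<le> q \<Longrightarrow> energy f q \<le> (real q)\<^sup>2 / 300"
  shows False
proof -
  \<comment> \<open>The assumed bound at \<open>q = 4 * N\<close>, which dominates it at every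
    length that occurs.\<close>
  define s where "s = 16 * (real N)\<^sup>2 / 300"
  have s: "energy f q \<le> s" if "N \<le> q" "q \<le> 4 * N" for q
  proof -
    have "(real q)\<^sup>2 \<le> (real (4 * N))\<^sup>2" using that by (intro power_mono) auto
    then show ?thesis using small[OF that(1)] by (simp add: s_def power_mult_distrib)
  qed
  have "real N * (real N)\<^sup>2 = (\<Sum>q = N..<2*N. (real N)\<^sup>2)" by simp
  also have "\<dots> \<le> (\<Sum>q = N..<2*N. 4 * (\<Sum>k = 1..<q. (acorr f k q)\<^sup>2) + 5 * s)"
  proof (rule sum_mono)
    fix q assume q: "q \<in> {N..<2*N}"
    have "(real N)\<^sup>2 \<le> (real q)\<^sup>2" using q by (intro power_mono) auto
    moreover have "energy f q \<le> s" "energy f (2*q) \<le> s"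
      using q by (auto intro!: s)
    moreover have "0 < q" using q \<open>0 < N\<close> by auto
    note square_le_energy[of f q, OF f this]
    ultimately show "(real N)\<^sup>2 \<le> 4 * (\<Sum>k = 1..<q. (acorr f k q)\<^sup>2) + 5 * s"
      by linarith
  qed
  also have "\<dots> = 4 * (\<Sum>q = N..<2*N. \<Sum>k = 1..<q. (acorr f k q)\<^sup>2) + real N * (5 * s)"
    by (simp add: sum.distrib sum_distrib_left)
  also have "\<dots> \<le> 4 * (\<Sum>q = N..<4*N. energy f q) + real N * (5 * s)"
    using sum_acorr_le_sum_energy by simp
  also have "(\<Sum>q = N..<4*N. energy f q) \<le> (\<Sum>q = N..<4*N. s)"
    using s by (intro sum_mono) auto
  \<comment> \<open>There are \<open>3 * N\<close> energies with factor \<open>4\<close>, and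
    \<open>N\<close> terms \<open>5 * s\<close>, so \<open>12 + 5 = 17\<close>. The contradiction is
    \<open>17 * 16 = 272 < 300\<close>.\<close>
  finally have "real N * (real N)\<^sup>2 \<le> 17 * (real N * s)" by (simp add: mult_ac)
  moreover have "real N * (real N)\<^sup>2 > 0" using \<open>0 < N\<close> by simp
  ultimately show False by (simp add: s_def)
qed

section \<open>Integration over the circle and Parseval's identity\<close>

lemma integral_circle:
  fixes f :: "complex \<Rightarrow> real"
  assumes [measurable]: "f \<in> borel_measurable borel"
  shows "(LINT z|circle_measure. f z) = (LBINT t:{0..<2*pi}. f (cis t)) / (2 * pi)"
proof -
  have [measurable]: "cis \<in> borel_measurable borel"
    by (intro borel_measurable_continuous_onI continuous_intros)
  have "(LINT z|circle_measure. f z) = (LINT t|uniform_measure lborel {0..<2*pi}. f (cis t))"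
    unfolding circle_measure_def by (intro integral_distr) auto
  also have "uniform_measure lborel {0..<2*pi} = density lborel (\<lambda>t. ennreal (indicator {0..<2*pi} t / (2*pi)))"
    unfolding uniform_measure_def
    by (intro density_cong) (auto simp: divide_ennreal[symmetric] ennreal_indicator split: split_indicator)
  also have "(LINT t|\<dots>. f (cis t)) = (LINT t|lborel. indicator {0..<2*pi} t / (2*pi) * f (cis t))"
    by (subst integral_density) auto
  also have "\<dots> = (LBINT t:{0..<2*pi}. f (cis t)) / (2 * pi)"
    by (simp add: set_lebesgue_integral_def)
  finally show ?thesis .
qed

lemma has_integral_cos_mult:
  "((\<lambda>t. cos (of_int m * t)) has_integral (if m = 0 then 2 * pi else 0)) {0..2*pi}"
proof (cases "m = 0")
  case True
  then show ?thesis using has_integral_const_real[of "1::real" 0 "2*pi"] by simp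
next
  case False
  have "((\<lambda>t. cos (of_int m * t)) has_integral
      sin (of_int m * (2*pi)) / of_int m - sin (of_int m * 0) / of_int m) {0..2*pi}"
    using False
    by (intro fundamental_theorem_of_calculus)
       (auto intro!: derivative_eq_intros simp flip: has_real_derivative_iff_has_vector_derivative)
  moreover have "sin (of_int m * (2*pi)) = 0"
    using sin_int_2pin[of m] by (simp add: mult.commute)
  ultimately show ?thesis using False by simp
qed

text \<open>Orthogonality of cosines, by the product-to-sum formula. As \<open>0 \<notin> K\<close>,
  the frequency \<open>k + l\<close> never vanishes, so only the difference terms with
  \<open>k = l\<close> survive.\<close>

lemma has_integral_cosine_sum_squared:
  assumes "finite K" "0 \<notin> K"
  shows "((\<lambda>t. (\<Sum>k\<in>K. a k * cos (real k * t))\<^sup>2) has_integral (pi * (\<Sum>k\<in>K. (a k)\<^sup>2))) {0..2*pi}"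
proof -
  have prod: "((\<lambda>t. a k * a l / 2 * (cos (of_int (int k - int l) * t) + cos (of_int (int k + int l) * t)))
      has_integral (if k = l then pi * (a k * a l) else 0)) {0..2*pi}"
    if "k \<in> K" "l \<in> K" for k l
  proof -
    have "k + l \<noteq> 0" using that assms by (metis add_is_0)
    then have "int k + int l \<noteq> 0" by linarith
    then show ?thesis
      using has_integral_mult_right[OF has_integral_add[OF has_integral_cos_mult[of "int k - int l"]
          has_integral_cos_mult[of "int k + int l"]], of "a k * a l / 2"]
      by (auto simp: mult_ac split: if_splits)
  qed
  have "((\<lambda>t. \<Sum>k\<in>K. \<Sum>l\<in>K. a k * a l / 2 * (cos (of_int (int k - int l) * t) + cos (of_int (int k + int l) * t)))
      has_integral (\<Sum>k\<in>K. \<Sum>l\<in>K. if k = l then pi * (a k * a l) else 0)) {0..2*pi}"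
    using assms prod by (intro has_integral_sum) auto
  also have "(\<lambda>t. \<Sum>k\<in>K. \<Sum>l\<in>K. a k * a l / 2 * (cos (of_int (int k - int l) * t) + cos (of_int (int k + int l) * t)))
      = (\<lambda>t. (\<Sum>k\<in>K. a k * cos (real k * t))\<^sup>2)"
    unfolding power2_eq_square sum_product
    by (intro ext sum.cong refl) (simp add: cos_add cos_diff algebra_simps)
  also have "(\<Sum>k\<in>K. \<Sum>l\<in>K. if k = l then pi * (a k * a l) else 0) = pi * (\<Sum>k\<in>K. (a k)\<^sup>2)"
    using assms by (simp add: sum_distrib_left power2_eq_square)
  finally show ?thesis .
qed

text \<open>The Fourier coefficients of the squared modulus are the autocorrelations; opposite
  shifts combine into \<open>2 * cos\<close>, and the shift \<open>0\<close> gives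
  \<open>q\<close>.\<close>

lemma cmod_cis_sum_squared:
  assumes f: "\<And>j. f j \<in> {-1, 1}" and "0 < q"
  shows "(cmod (\<Sum>j<q. complex_of_real (f j) * cis t ^ j))\<^sup>2
    = real q + (\<Sum>k = 1..<q. 2 * acorr f k (q - k) * cos (real k * t))"
proof -
  have "(cmod (\<Sum>j<q. complex_of_real (f j) * cis t ^ j))\<^sup>2
      = (\<Sum>i<q. \<Sum>j<q. f i * f j * cos (of_int (int j - int i) * t))"
    unfolding cmod_power2 Re_sum Im_sum
    unfolding power2_eq_square sum_product sum.distrib[symmetric]
    by (intro sum.cong refl)
       (simp add: Complex.DeMoivre cos_diff left_diff_distrib algebra_simps)
  also have "\<dots> = (\<Sum>d\<in>{- int q<..<int q}. xcorr f {..<q} {..<q} d * cos (of_int d * t))"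
    by (subst sum_xcorr) auto
  also have "\<dots> = real q + 2 * (\<Sum>k = 1..<q. acorr f k (q - k) * cos (real k * t))"
    using \<open>0 < q\<close> by (subst sum_symmetric_interval)
      (auto simp: xcorr_minus xcorr_initial xcorr_initial[of f q 0, simplified] acorr_zero[OF f])
  finally show ?thesis by (simp add: sum_distrib_left mult.assoc)
qed

lemma integral_circle_P:
  assumes f: "\<And>j. f j \<in> {-1, 1}" and "0 < q"
  shows "(LINT z|circle_measure. \<bar>(cmod (P f q z))\<^sup>2 - 1\<bar>\<^sup>2) = 2 * energy f q / (real q)\<^sup>2"
proof -
  have P: "\<bar>(cmod (P f q (cis t)))\<^sup>2 - 1\<bar>\<^sup>2
      = (\<Sum>k = 1..<q. 2 * acorr f k (q - k) / real q * cos (real k * t))\<^sup>2" for t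
  proof -
    have "(cmod (P f q (cis t)))\<^sup>2 - 1 = (\<Sum>k = 1..<q. 2 * acorr f k (q - k) * cos (real k * t)) / real q"
      using \<open>0 < q\<close> by (simp add: P_def norm_mult power_mult_distrib norm_divide
          power_divide cmod_cis_sum_squared[OF f \<open>0 < q\<close>] field_simps)
    then show ?thesis by (simp add: sum_divide_distrib)
  qed
  let ?g = "\<lambda>t. (\<Sum>k = 1..<q. 2 * acorr f k (q - k) / real q * cos (real k * t))\<^sup>2"
  have "(\<lambda>z. \<bar>(cmod (P f q z))\<^sup>2 - 1\<bar>\<^sup>2) \<in> borel_measurable borel"
    unfolding P_def by (intro borel_measurable_continuous_onI continuous_intros)
  then have "(LINT z|circle_measure. \<bar>(cmod (P f q z))\<^sup>2 - 1\<bar>\<^sup>2) = (LBINT t:{0..<2*pi}. ?g t) / (2 * pi)"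
    by (simp only: integral_circle P)
  also have "(LBINT t:{0..<2*pi}. ?g t) = integral {0..<2*pi} ?g"
  proof (rule set_borel_integral_eq_integral)
    have "set_integrable lborel {0..2*pi} ?g"
      by (intro borel_integrable_atLeastAtMost' continuous_intros)
    then show "set_integrable lborel {0..<2*pi} ?g"
      by (rule set_integrable_subset) auto
  qed
  \<comment> \<open>The two intervals differ only in the endpoint \<open>2*pi\<close>, a null
    set.\<close>
  also have "\<dots> = integral {0..2*pi} ?g"
    by (rule integral_subset_negligible)
       (auto intro: negligible_subset[of "{2*pi}"])
  also have "\<dots> = pi * (\<Sum>k = 1..<q. (2 * acorr f k (q - k) / real q)\<^sup>2)"
    by (intro integral_unique has_integral_cosine_sum_squared) auto
  also have "\<dots> = 4 * pi * energy f q / (real q)\<^sup>2"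
    by (simp add: energy_def power_mult_distrib power_divide sum_distrib_left sum_divide_distrib mult_ac)
  finally show ?thesis by simp
qed

theorem theorem6p3:
  fixes \<epsilon> :: "nat \<Rightarrow> real"
  assumes "\<And>j. \<epsilon> j \<in> {-1, 1}"
    and "(\<lambda>q. LINT z|circle_measure. \<bar>(cmod (P \<epsilon> q z))\<^sup>2 - 1\<bar>\<^sup>2) \<longlonglongrightarrow> 0"
  shows "\<not> (\<lambda>q. (1 / real q) * (\<Sum>j = 1..<q. (cmod (Q \<epsilon> q (xi q j))) ^ 4)) \<longlonglongrightarrow> 1"
proof -
  \<comment> \<open>By \<open>integral_circle_P\<close>, \<open>1 / 150 = 2 / 300\<close>
    corresponds to the energy bound \<open>q^2 / 300\<close> of
    \<open>energy_not_small\<close>.\<close>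
  have "eventually (\<lambda>q. (LINT z|circle_measure. \<bar>(cmod (P \<epsilon> q z))\<^sup>2 - 1\<bar>\<^sup>2) < 1 / 150) sequentially"
    using assms(2) by (rule order_tendstoD) simp
  then obtain N where N: "\<And>q. N \<le> q \<Longrightarrow> (LINT z|circle_measure. \<bar>(cmod (P \<epsilon> q z))\<^sup>2 - 1\<bar>\<^sup>2) < 1 / 150"
    by (auto simp: eventually_sequentially)
  \<comment> \<open>Taking \<open>max 1 N\<close> keeps \<open>q\<close> positive, so that the
    division by \<open>q^2\<close> can be undone.\<close>
  have "energy \<epsilon> q \<le> (real q)\<^sup>2 / 300" if "max 1 N \<le> q" for q
  proof -
    have "2 * energy \<epsilon> q / (real q)\<^sup>2 < 1 / 150"
      using that N[of q] integral_circle_P[of \<epsilon> q, OF assms(1)] by simp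
    then show ?thesis using that by (simp add: pos_divide_less_eq)
  qed
  then have False
    by (intro energy_not_small[of \<epsilon> "max 1 N", OF assms(1)]) auto
  then show ?thesis ..
qed

end
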